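(* Let $k\ge1$, $g\ge1$ and $t\ge k$ be integers, $p\in(0,1)$, $q=1-p$. Let $f(n,t)=P(L_n\ge t)$ for $n\ge1$, where $L_n$ is the length of the longest success run (of order $k$ with gap $g$) in $n$ independent Bernoulli trials with success probability $p$ ($L_n=0$ if there is no success run), and $f(0,t)=0$. Then, as formal power series in $z$, $$\sum_{n=0}^\infty f(n,t)z^n=\frac{1-pz}{1-z}\cdot\frac{p^tz^t}{1-z+qp^k(z^{k+1}-z^{k+g})+qp^tz^{t+g}}.$$
   Context: Consider a sequence of $n$ independent trials, each $S$ (success) with probability $p$ or $F$ (failure) with probability $q=1-p$. The success runs (of order $k$ with gap $g$) are defined inductively. The first success run (if it exists) is the first run of at least $k$ consecutive successes, taken maximal (it cannot be extended to a longer run). A success run terminates at trial $m$ if trial $m$ is its last success, i.e. either $m=n$ or trial $m+1$ is a failure. If the $j$-th success run terminates at trial $m$, then the $(j+1)$-th success run (if it exists) is the first run of at least $k$ consecutive successes which begins later than trial $m+g$, taken maximal among runs beginning later than trial $m+g$ (trials $m+1,\dots,m+g$ form the gap: an $F$ followed by $g-1$ arbitrary outcomes). *)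

theory Defs
  imports "HOL-Probability.Product_PMF" "HOL-Computational_Algebra.Formal_Power_Series"
begin

text \<open>
  An outcome of the trials is a function \<open>\<omega> :: nat \<Rightarrow> bool\<close>, read on the trials \<open>1, \<dots>, n\<close> only,
  with \<open>True\<close> for success. A run is given by its first trial \<open>a\<close> and its last trial \<open>b\<close>.
\<close>

definition consecutive_successes :: "nat \<Rightarrow> (nat \<Rightarrow> bool) \<Rightarrow> nat \<Rightarrow> nat \<Rightarrow> bool" where
  "consecutive_successes n \<omega> a b \<longleftrightarrow> 1 \<le> a \<and> a \<le> b \<and> b \<le> n \<and> (\<forall>i\<in>{a..b}. \<omega> i)"

definition run_length :: "nat \<Rightarrow> nat \<Rightarrow> nat" where
  "run_length a b = Suc b - a"

text \<open>
  The run \<open>a, \<dots>, b\<close> begins later than trial \<open>s\<close> and is maximal among the runs that do so: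
  it may start at \<open>s + 1\<close> even if trial \<open>s\<close> is a success.
\<close>

definition maximal_run_after :: "nat \<Rightarrow> (nat \<Rightarrow> bool) \<Rightarrow> nat \<Rightarrow> nat \<Rightarrow> nat \<Rightarrow> bool" where
  "maximal_run_after n \<omega> s a b \<longleftrightarrow>
     s < a \<and> consecutive_successes n \<omega> a b \<and>
     (\<forall>a' b'. s < a' \<and> consecutive_successes n \<omega> a' b' \<and> {a..b} \<subseteq> {a'..b'}
        \<longrightarrow> a' = a \<and> b' = b)"

definition first_run_after :: "nat \<Rightarrow> nat \<Rightarrow> (nat \<Rightarrow> bool) \<Rightarrow> nat \<Rightarrow> nat \<Rightarrow> nat \<Rightarrow> bool" where
  "first_run_after k n \<omega> s a b \<longleftrightarrow>
     maximal_run_after n \<omega> s a b \<and> k \<le> run_length a b \<and>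
     (\<forall>a' b'. s < a' \<and> consecutive_successes n \<omega> a' b' \<and> k \<le> run_length a' b' \<longrightarrow> a \<le> a')"

text \<open>
  \<open>success_run k g n \<omega> j a b\<close>: the \<open>j\<close>-th success run of order \<open>k\<close> with gap \<open>g\<close> exists and
  consists of the trials \<open>a, \<dots>, b\<close>.
\<close>

inductive success_run :: "nat \<Rightarrow> nat \<Rightarrow> nat \<Rightarrow> (nat \<Rightarrow> bool) \<Rightarrow> nat \<Rightarrow> nat \<Rightarrow> nat \<Rightarrow> bool"
  for k g n :: nat and \<omega> :: "nat \<Rightarrow> bool" where
  first: "first_run_after k n \<omega> 0 a b \<Longrightarrow> success_run k g n \<omega> 1 a b"
| later: "success_run k g n \<omega> j a m \<Longrightarrow> first_run_after k n \<omega> (m + g) a' b' \<Longrightarrow>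
    success_run k g n \<omega> (Suc j) a' b'"

text \<open>Inserting \<open>0\<close> makes the value \<open>0\<close> if there is no success run.\<close>

definition longest_run :: "nat \<Rightarrow> nat \<Rightarrow> nat \<Rightarrow> (nat \<Rightarrow> bool) \<Rightarrow> nat" where
  "longest_run k g n \<omega> = Max (insert 0 {run_length a b | j a b. success_run k g n \<omega> j a b})"

definition bernoulli_trials :: "real \<Rightarrow> nat \<Rightarrow> (nat \<Rightarrow> bool) pmf" where
  "bernoulli_trials p n = Pi_pmf {1..n} False (\<lambda>_. bernoulli_pmf p)"

definition longest_run_prob :: "real \<Rightarrow> nat \<Rightarrow> nat \<Rightarrow> nat \<Rightarrow> nat \<Rightarrow> real" where
  "longest_run_prob p k g n t =
     (if n = 0 then 0
      else measure_pmf.prob (bernoulli_trials p n) {\<omega>. t \<le> longest_run k g n \<omega>})"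

end

(* Condition on the number r of successes before the first failure. If r < k, the process restarts
   after that failure; if k <= r < t, it restarts g - 1 trials later; if r >= t, a long run has
   occurred. Hence the generating function F satisfies
     F = p^t z^t / (1 - z) + F * (sum_{r<k} p^r q z^(r+1) + sum_{k<=r<t} p^r q z^(r+g)),
   and the two geometric sums give the denominator of the closed form. The conditioning is carried
   out one trial at a time, on the probability of a long run given r leading successes. *)
theory Submission
  imports Defs
begin

subsection \<open>Chains of success runs\<close>

text \<open>
  Same chains as \<open>success_run\<close>, but unfolded from the first run instead of the last and with an
  arbitrary starting trial, so that the remainder of the process after a failure is again such a chain.
\<close>

inductive run_chain :: "nat \<Rightarrow> nat \<Rightarrow> nat \<Rightarrow> (nat \<Rightarrow> bool) \<Rightarrow> nat \<Rightarrow> nat \<Rightarrow> nat \<Rightarrow> bool"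
  for k g n :: nat and \<omega> :: "nat \<Rightarrow> bool" where
  here: "first_run_after k n \<omega> s a b \<Longrightarrow> run_chain k g n \<omega> s a b"
| skip: "first_run_after k n \<omega> s a b \<Longrightarrow> run_chain k g n \<omega> (b + g) a' b' \<Longrightarrow>
    run_chain k g n \<omega> s a' b'"

lemma run_chain_unfold:
  "run_chain k g n \<omega> s a b \<longleftrightarrow>
     first_run_after k n \<omega> s a b \<or>
     (\<exists>a' b'. first_run_after k n \<omega> s a' b' \<and> run_chain k g n \<omega> (b' + g) a b)"
  by (subst run_chain.simps) auto

text \<open>\<open>success_run\<close> grows at its end and \<open>run_chain\<close> at its front;
  appending a run to a chain reconciles the two directions of recursion.\<close>

lemma run_chain_snoc:
  assumes "run_chain k g n \<omega> s a m" "first_run_after k n \<omega> (m + g) a' b'"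
  shows "run_chain k g n \<omega> s a' b'"
  using assms by (induction rule: run_chain.induct) (blast intro: run_chain.intros)+

lemma run_chain_if_success_run:
  "success_run k g n \<omega> j a b \<Longrightarrow> run_chain k g n \<omega> 0 a b"
  by (induction rule: success_run.induct) (blast intro: run_chain.intros run_chain_snoc)+

text \<open>The condition on \<open>s\<close> is the invariant of the induction: \<open>skip\<close>
  moves the start to \<open>g\<close> trials past the end of a success run already reached.\<close>

lemma success_run_if_run_chain:
  assumes "run_chain k g n \<omega> s a b" "s = 0 \<or> (\<exists>j a m. success_run k g n \<omega> j a m \<and> s = m + g)"
  shows "\<exists>j. success_run k g n \<omega> j a b"
  using assms by (induction rule: run_chain.induct) (blast intro: success_run.intros)+

lemma ex_success_run_iff_run_chain:
  "(\<exists>j. success_run k g n \<omega> j a b) \<longleftrightarrow> run_chain k g n \<omega> 0 a b"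
  using run_chain_if_success_run success_run_if_run_chain by blast

lemma first_run_after_bounds:
  "first_run_after k n \<omega> s a b \<Longrightarrow> s < a \<and> a \<le> b \<and> b \<le> n \<and> k \<le> run_length a b"
  by (auto simp: first_run_after_def maximal_run_after_def consecutive_successes_def)

lemma run_chain_bounds: "run_chain k g n \<omega> s a b \<Longrightarrow> s < a \<and> a \<le> b \<and> b \<le> n"
  by (induction rule: run_chain.induct) (auto dest: first_run_after_bounds)

definition long_run_after :: "nat \<Rightarrow> nat \<Rightarrow> nat \<Rightarrow> nat \<Rightarrow> (nat \<Rightarrow> bool) \<Rightarrow> nat \<Rightarrow> bool" where
  "long_run_after k g t n \<omega> s \<longleftrightarrow> (\<exists>a b. run_chain k g n \<omega> s a b \<and> t \<le> run_length a b)"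

lemma long_run_after_unfold:
  "long_run_after k g t n \<omega> s \<longleftrightarrow>
     (\<exists>a b. first_run_after k n \<omega> s a b \<and> (t \<le> run_length a b \<or> long_run_after k g t n \<omega> (b + g)))"
  unfolding long_run_after_def by (subst run_chain_unfold) blast

lemma not_long_run_after_end: "n \<le> s \<Longrightarrow> \<not> long_run_after k g t n \<omega> s"
  unfolding long_run_after_def using run_chain_bounds by fastforce

lemma le_longest_run_iff:
  assumes "1 \<le> t"
  shows "t \<le> longest_run k g n \<omega> \<longleftrightarrow> long_run_after k g t n \<omega> 0"
proof -
  let ?A = "{run_length a b | j a b. success_run k g n \<omega> j a b}"
  have A: "?A = {run_length a b | a b. run_chain k g n \<omega> 0 a b}"
    using ex_success_run_iff_run_chain[of k g n \<omega>] by blast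
  \<comment> \<open>Finiteness lets \<open>Max\<close> be compared with \<open>t\<close>
    elementwise; the inserted 0 stays below \<open>t\<close> because
    \<open>1 \<le> t\<close>.\<close>
  have "?A \<subseteq> {..n}"
    unfolding A using run_chain_bounds[of k g n \<omega> 0] by (force simp: run_length_def)
  then have "finite ?A"
    by (rule finite_subset) simp
  then have "t \<le> longest_run k g n \<omega> \<longleftrightarrow> (\<exists>x\<in>insert 0 ?A. t \<le> x)"
    unfolding longest_run_def by (subst Max_ge_iff) auto
  then show ?thesis
    using assms unfolding A long_run_after_def by auto
qed

section \<open>Invariance under shifting the trials\<close>

text \<open>Runs beginning after \<open>s\<close> read only trials after \<open>s\<close>, so
  agreement is asked only there; the trials of \<open>\<omega>\<close> up to \<open>s + d\<close>
  stay arbitrary.\<close>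

lemma consecutive_successes_shift:
  assumes "\<And>i. s < i \<Longrightarrow> i \<le> n \<Longrightarrow> \<omega>' i = \<omega> (i + d)" "s < a"
  shows "consecutive_successes (n + d) \<omega> (a + d) (b + d) \<longleftrightarrow> consecutive_successes n \<omega>' a b"
proof -
  have "(\<forall>i\<in>{a + d..b + d}. \<omega> i) \<longleftrightarrow> (\<forall>i\<in>{a..b}. \<omega> (i + d))"
    by (simp only: ball_simps flip: image_add_atLeastAtMost')
  then show ?thesis
    using assms by (auto simp: consecutive_successes_def)
qed

lemma first_run_after_shift:
  assumes "\<And>i. s < i \<Longrightarrow> i \<le> n \<Longrightarrow> \<omega>' i = \<omega> (i + d)"
  shows "first_run_after k (n + d) \<omega> (s + d) (a + d) (b + d) \<longleftrightarrow> first_run_after k n \<omega>' s a b"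
proof -
  \<comment> \<open>A run beginning after \<open>s + d\<close> has both ends at least
    \<open>d\<close>, hence is a shifted run. Keeping \<open>P\<close> general serves maximality and
    firstness alike.\<close>
  have all: "(\<forall>a' b'. s + d < a' \<and> consecutive_successes (n + d) \<omega> a' b' \<longrightarrow> P a' b') \<longleftrightarrow>
      (\<forall>a' b'. s < a' \<and> consecutive_successes n \<omega>' a' b' \<longrightarrow> P (a' + d) (b' + d))" for P
  proof safe
    fix a' b'
    assume *: "\<forall>a' b'. s < a' \<and> consecutive_successes n \<omega>' a' b' \<longrightarrow> P (a' + d) (b' + d)"
      and a': "s + d < a'" and c: "consecutive_successes (n + d) \<omega> a' b'"
    have "d \<le> a'" "d \<le> b'"
      using a' c by (auto simp: consecutive_successes_def)
    then obtain a'' b'' where ab: "a' = a'' + d" "b' = b'' + d"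
      by (metis le_add_diff_inverse2)
    then show "P a' b'"
      using * a' c consecutive_successes_shift[of s n \<omega>' \<omega> d a'' b'', OF assms] by simp
  next
    fix a' b'
    assume "\<forall>a' b'. s + d < a' \<and> consecutive_successes (n + d) \<omega> a' b' \<longrightarrow> P a' b'"
      and "s < a'" "consecutive_successes n \<omega>' a' b'"
    then show "P (a' + d) (b' + d)"
      using consecutive_successes_shift[of s n \<omega>' \<omega> d a' b', OF assms] by simp
  qed
  have conj: "(s + d < a' \<and> consecutive_successes (n + d) \<omega> a' b' \<and> Q \<longrightarrow> R) \<longleftrightarrow>
      (s + d < a' \<and> consecutive_successes (n + d) \<omega> a' b' \<longrightarrow> (Q \<longrightarrow> R))" for a' b' Q R
    by blast
  show ?thesis
    unfolding first_run_after_def maximal_run_after_def conj all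
    using consecutive_successes_shift[of s n \<omega>' \<omega> d a b, OF assms]
    by (auto simp: run_length_def)
qed

lemma run_chain_shift_if:
  assumes "run_chain k g n \<omega>' s a b" "\<And>i. s < i \<Longrightarrow> i \<le> n \<Longrightarrow> \<omega>' i = \<omega> (i + d)"
  shows "run_chain k g (n + d) \<omega> (s + d) (a + d) (b + d)"
  using assms
proof (induction rule: run_chain.induct)
  case (here s a b)
  then show ?case
    using first_run_after_shift[of s n \<omega>' \<omega> d] by (blast intro: run_chain.here)
next
  case (skip s a b a' b')
  \<comment> \<open>The next link starts at \<open>b + g\<close>, beyond \<open>s\<close>, so the
    agreement assumed after \<open>s\<close> covers what the induction hypothesis asks for.\<close>
  have "s < b"
    using skip.hyps by (auto dest: first_run_after_bounds)
  then have "run_chain k g (n + d) \<omega> (b + d + g) (a' + d) (b' + d)"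
    using skip by (simp add: ac_simps)
  then show ?case
    using skip first_run_after_shift[of s n \<omega>' \<omega> d] by (blast intro: run_chain.skip)
qed

text \<open>Rule induction needs a variable start, hence the equation for \<open>s\<^sub>0\<close>.
  All runs of the chain begin beyond \<open>d\<close>, so their ends can be shifted back.\<close>

lemma run_chain_shift_only_if:
  assumes "run_chain k g (n + d) \<omega> s\<^sub>0 a\<^sub>0 b\<^sub>0" "s\<^sub>0 = s + d"
    "\<And>i. s < i \<Longrightarrow> i \<le> n \<Longrightarrow> \<omega>' i = \<omega> (i + d)"
  shows "\<exists>a b. a\<^sub>0 = a + d \<and> b\<^sub>0 = b + d \<and> run_chain k g n \<omega>' s a b"
  using assms
proof (induction arbitrary: s rule: run_chain.induct)
  case (here s\<^sub>0 a b)
  have "d \<le> a" "d \<le> b"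
    using here first_run_after_bounds[OF here.hyps] by auto
  then obtain a' b' where ab: "a = a' + d" "b = b' + d"
    by (metis le_add_diff_inverse2)
  then show ?case
    using here first_run_after_shift[of s n \<omega>' \<omega> d k a' b'] by (blast intro: run_chain.here)
next
  case (skip s\<^sub>0 a b a\<^sub>1 b\<^sub>1)
  have "d \<le> a" "d \<le> b"
    using skip.prems first_run_after_bounds[OF skip.hyps(1)] by auto
  then obtain a' b' where ab: "a = a' + d" "b = b' + d"
    by (metis le_add_diff_inverse2)
  then have f: "first_run_after k n \<omega>' s a' b'"
    using skip first_run_after_shift[of s n \<omega>' \<omega> d k a' b'] by blast
  then have "s < b'"
    by (auto dest: first_run_after_bounds)
  then have "\<exists>a b. a\<^sub>1 = a + d \<and> b\<^sub>1 = b + d \<and> run_chain k g n \<omega>' (b' + g) a b"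
    using skip by (intro skip.IH) (auto simp: ab)
  then show ?case
    using f by (blast intro: run_chain.skip)
qed

lemma long_run_after_shift:
  assumes "\<And>i. s < i \<Longrightarrow> i \<le> n \<Longrightarrow> \<omega>' i = \<omega> (i + d)"
  shows "long_run_after k g t (n + d) \<omega> (s + d) \<longleftrightarrow> long_run_after k g t n \<omega>' s"
proof
  assume "long_run_after k g t (n + d) \<omega> (s + d)"
  then obtain a b where "run_chain k g (n + d) \<omega> (s + d) a b" "t \<le> run_length a b"
    by (auto simp: long_run_after_def)
  then show "long_run_after k g t n \<omega>' s"
    using run_chain_shift_only_if[of k g n d \<omega> "s + d" a b s \<omega>'] assms
    by (fastforce simp: long_run_after_def run_length_def)
next
  assume "long_run_after k g t n \<omega>' s"
  then obtain a b where "run_chain k g n \<omega>' s a b" "t \<le> run_length a b"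
    by (auto simp: long_run_after_def)
  then have "run_chain k g (n + d) \<omega> (s + d) (a + d) (b + d)" "t \<le> run_length (a + d) (b + d)"
    using run_chain_shift_if[of k g n \<omega>' s a b \<omega> d] assms by (auto simp: run_length_def)
  then show "long_run_after k g t (n + d) \<omega> (s + d)"
    unfolding long_run_after_def by blast
qed

subsection \<open>The initial block of successes\<close>

text \<open>A run starting at or before trial \<open>Suc r\<close> cannot include that trial, so it
  has at most \<open>r < k\<close> trials. Starting later therefore loses no candidate.\<close>

lemma first_run_after_short_block:
  assumes "r < k" "r = n \<or> \<not> \<omega> (Suc r)"
  shows "first_run_after k n \<omega> 0 a b \<longleftrightarrow> first_run_after k n \<omega> (Suc r) a b"
proof -
  have late: "Suc r < a'" if "0 < a'" "consecutive_successes n \<omega> a' b'" "k \<le> run_length a' b'" for a' b'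
  proof (rule ccontr)
    assume "\<not> Suc r < a'"
    moreover from this have "b' \<le> r"
      using that assms unfolding consecutive_successes_def
      by (metis atLeastAtMost_iff not_less not_less_eq_eq)
    ultimately show False
      using that assms by (auto simp: run_length_def)
  qed
  \<comment> \<open>Maximality ranges over runs of any length; those containing
    \<open>a, ..., b\<close> inherit length at least \<open>k\<close>, so \<open>late\<close>
    applies to them.\<close>
  have mono: "k \<le> run_length a' b'" if "k \<le> run_length a b" "{a..b} \<subseteq> {a'..b'}" "a \<le> b" for a' b'
    using that by (auto simp: run_length_def)
  show ?thesis
  proof
    assume "first_run_after k n \<omega> 0 a b"
    then show "first_run_after k n \<omega> (Suc r) a b"
      unfolding first_run_after_def maximal_run_after_def by (meson late less_trans zero_less_Suc)
  next
    assume *: "first_run_after k n \<omega> (Suc r) a b"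
    then have ab: "a \<le> b" "k \<le> run_length a b"
      by (auto dest: first_run_after_bounds)
    show "first_run_after k n \<omega> 0 a b"
      unfolding first_run_after_def maximal_run_after_def
    proof (intro conjI allI impI; (elim conjE)?)
      show "0 < a" "consecutive_successes n \<omega> a b" "k \<le> run_length a b"
        using * by (auto simp: first_run_after_def maximal_run_after_def)
    next
      fix a' b'
      assume "0 < a'" "consecutive_successes n \<omega> a' b'" "{a..b} \<subseteq> {a'..b'}"
      moreover from this have "Suc r < a'"
        using late mono ab by blast
      ultimately show "a' = a" "b' = b"
        using * unfolding first_run_after_def maximal_run_after_def by blast+
    next
      fix a' b'
      assume "0 < a'" "consecutive_successes n \<omega> a' b'" "k \<le> run_length a' b'"
      then show "a \<le> a'"
        using * late unfolding first_run_after_def by blast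
    qed
  qed
qed

text \<open>The block starts at the earliest possible trial, which forces \<open>a = 1\<close>. The
  failure or the end of the trials after \<open>r\<close> stops the run there, and maximality makes
  it the whole block.\<close>

lemma first_run_after_long_block:
  assumes "1 \<le> k" "k \<le> r" "r \<le> n" "\<And>i. 1 \<le> i \<Longrightarrow> i \<le> r \<Longrightarrow> \<omega> i" "r = n \<or> \<not> \<omega> (Suc r)"
  shows "first_run_after k n \<omega> 0 a b \<longleftrightarrow> a = 1 \<and> b = r"
proof -
  have block: "consecutive_successes n \<omega> 1 r" "k \<le> run_length 1 r"
    using assms by (auto simp: consecutive_successes_def run_length_def)
  have ends: "b' \<le> r" if "consecutive_successes n \<omega> 1 b'" for b'
    using that assms(5) unfolding consecutive_successes_def
    by (metis atLeastAtMost_iff le_SucI not_less_eq_eq le_add1 plus_1_eq_Suc)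
  show ?thesis
  proof
    assume *: "first_run_after k n \<omega> 0 a b"
    then have "a \<le> 1" "0 < a"
      using block unfolding first_run_after_def maximal_run_after_def by blast+
    then have "a = 1"
      by simp
    moreover from this have "b \<le> r"
      using ends * by (simp add: first_run_after_def maximal_run_after_def)
    ultimately have "{a..b} \<subseteq> {1..r}"
      by auto
    then show "a = 1 \<and> b = r"
      using * block unfolding first_run_after_def maximal_run_after_def by (metis less_one)
  next
    assume *: "a = 1 \<and> b = r"
    have "a' = 1 \<and> b' = r"
      if "0 < a'" "consecutive_successes n \<omega> a' b'" "{1..r} \<subseteq> {a'..b'}" for a' b'
    proof -
      have "a' = 1" "r \<le> b'"
        using that assms by auto
      then show ?thesis
        using ends that by fastforce
    qed
    then show "first_run_after k n \<omega> 0 a b"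
      using * block unfolding first_run_after_def maximal_run_after_def by auto
  qed
qed

section \<open>Outcomes with prepended trials\<close>

definition prepend_successes :: "nat \<Rightarrow> (nat \<Rightarrow> bool) \<Rightarrow> nat \<Rightarrow> bool" where
  "prepend_successes r \<omega> i \<longleftrightarrow> i \<le> r \<or> \<omega> (i - r)"

text \<open>Reindexing followed by an update at 1 is the form delivered by
  \<open>Pi_pmf_bij_betw\<close> and \<open>Pi_pmf_insert'\<close>.\<close>

definition prepend_trial :: "bool \<Rightarrow> (nat \<Rightarrow> bool) \<Rightarrow> nat \<Rightarrow> bool" where
  "prepend_trial x \<omega> = (\<omega> \<circ> (\<lambda>i. i - 1))(1 := x)"

lemma prepend_successes_True:
  "prepend_successes r (prepend_trial True \<omega>) = prepend_successes (Suc r) \<omega>"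
  by (auto simp: prepend_successes_def prepend_trial_def fun_eq_iff le_Suc_eq)

text \<open>The two outcomes may differ at index 0, which is not a trial; the shift by 0 ignores
  that index.\<close>

lemma long_run_after_prepend_0:
  "long_run_after k g t n (prepend_successes 0 \<omega>) 0 \<longleftrightarrow> long_run_after k g t n \<omega> 0"
  using long_run_after_shift[of 0 n \<omega> "prepend_successes 0 \<omega>" 0]
  by (simp add: prepend_successes_def)

lemma long_run_after_prepend_trial:
  "long_run_after k g t (Suc n) (prepend_trial x \<omega>) (Suc s) \<longleftrightarrow> long_run_after k g t n \<omega> s"
  using long_run_after_shift[of s n \<omega> "prepend_trial x \<omega>" 1]
  by (simp add: prepend_trial_def)

text \<open>Base case, with no random trial left: a block of at least \<open>k\<close> successes is
  the only run, since the next would begin after trial \<open>r + g\<close>, past the end.\<close>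

lemma long_run_after_all_successes:
  assumes "1 \<le> k" "k \<le> t"
  shows "long_run_after k g t r (prepend_successes r \<omega>) 0 \<longleftrightarrow> t \<le> r"
proof (cases "k \<le> r")
  case True
  have "first_run_after k r (prepend_successes r \<omega>) 0 a b \<longleftrightarrow> a = 1 \<and> b = r" for a b
    using assms True by (intro first_run_after_long_block) (auto simp: prepend_successes_def)
  then show ?thesis
    using not_long_run_after_end[of r "r + g"]
    by (subst long_run_after_unfold) (simp add: run_length_def)
next
  case False
  then have "first_run_after k r (prepend_successes r \<omega>) 0 a b \<longleftrightarrow>
      first_run_after k r (prepend_successes r \<omega>) (Suc r) a b" for a b
    by (intro first_run_after_short_block) auto
  then have "\<not> first_run_after k r (prepend_successes r \<omega>) 0 a b" for a b
    using first_run_after_bounds[of k r _ "Suc r" a b] by fastforce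
  then show ?thesis
    using assms False by (subst long_run_after_unfold) simp
qed

text \<open>The failure at trial \<open>Suc r\<close> ends the block. A short block is no success
  run, so the process restarts after the failure; otherwise the gap reaches trial
  \<open>r + g\<close>, which is \<open>g - 1\<close> trials past it.\<close>

lemma long_run_after_prepend_False:
  assumes "1 \<le> k" "1 \<le> g" "k \<le> t"
  shows "long_run_after k g t (n + Suc r) (prepend_successes r (prepend_trial False \<omega>)) 0 \<longleftrightarrow>
    t \<le> r \<or> long_run_after k g t n \<omega> (if r < k then 0 else g - 1)"
proof -
  let ?\<omega> = "prepend_successes r (prepend_trial False \<omega>)"
  have shift: "long_run_after k g t (n + Suc r) ?\<omega> (s + Suc r) \<longleftrightarrow> long_run_after k g t n \<omega> s" for s
    by (rule long_run_after_shift) (auto simp: prepend_successes_def prepend_trial_def)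
  have neg: "\<not> ?\<omega> (Suc r)"
    by (simp add: prepend_successes_def prepend_trial_def)
  show ?thesis
  proof (cases "r < k")
    case True
    have "first_run_after k (n + Suc r) ?\<omega> 0 a b \<longleftrightarrow> first_run_after k (n + Suc r) ?\<omega> (Suc r) a b" for a b
      using True neg by (intro first_run_after_short_block) auto
    then have "long_run_after k g t (n + Suc r) ?\<omega> 0 \<longleftrightarrow> long_run_after k g t (n + Suc r) ?\<omega> (0 + Suc r)"
      by (subst (1 2) long_run_after_unfold) simp
    then show ?thesis
      using True assms by (simp only: shift) simp
  next
    case False
    have "first_run_after k (n + Suc r) ?\<omega> 0 a b \<longleftrightarrow> a = 1 \<and> b = r" for a b
      using False assms neg
      by (intro first_run_after_long_block) (auto simp: prepend_successes_def)
    then have "long_run_after k g t (n + Suc r) ?\<omega> 0 \<longleftrightarrow>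
        t \<le> r \<or> long_run_after k g t (n + Suc r) ?\<omega> (g - 1 + Suc r)"
      using assms by (subst long_run_after_unfold) (simp add: run_length_def add.commute)
    then show ?thesis
      using False by (simp only: shift) simp
  qed
qed

subsection \<open>Conditioning on the first trial\<close>

lemma bernoulli_trials_Suc:
  "bernoulli_trials p (Suc n) =
     bernoulli_pmf p \<bind> (\<lambda>x. map_pmf (prepend_trial x) (bernoulli_trials p n))"
proof -
  have "bij_betw (\<lambda>i. i - 1) {2..Suc n} {1..n}"
    by (rule bij_betwI[where g = Suc]) auto
  \<comment> \<open>Truncated subtraction sends 0 and 1 to 0, so indices outside
    \<open>{2..Suc n}\<close> go outside \<open>{1..n}\<close> and the default values match.\<close>
  then have *: "Pi_pmf {2..Suc n} False (\<lambda>_. bernoulli_pmf p) =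
      map_pmf (\<lambda>\<omega>. \<omega> \<circ> (\<lambda>i. i - 1)) (bernoulli_trials p n)"
    unfolding bernoulli_trials_def by (intro Pi_pmf_bij_betw) auto
  have "{1..Suc n} = insert 1 {2..Suc n}"
    by auto
  then have "bernoulli_trials p (Suc n) =
      Pi_pmf (insert 1 {2..Suc n}) False (\<lambda>_. bernoulli_pmf p)"
    unfolding bernoulli_trials_def by (rule arg_cong)
  also have "\<dots> = bernoulli_pmf p \<bind> (\<lambda>x. map_pmf (prepend_trial x) (bernoulli_trials p n))"
    by (subst Pi_pmf_insert')
      (auto simp: * map_pmf_def bind_assoc_pmf bind_return_pmf prepend_trial_def)
  finally show ?thesis .
qed

lemma prob_bernoulli_trials_Suc:
  assumes "0 \<le> p" "p \<le> 1"
  shows "measure_pmf.prob (bernoulli_trials p (Suc n)) {\<omega>. P \<omega>} =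
    p * measure_pmf.prob (bernoulli_trials p n) {\<omega>. P (prepend_trial True \<omega>)} +
    (1 - p) * measure_pmf.prob (bernoulli_trials p n) {\<omega>. P (prepend_trial False \<omega>)}"
proof -
  have "emeasure (measure_pmf (bernoulli_trials p (Suc n))) {\<omega>. P \<omega>} =
    ennreal (p * measure_pmf.prob (bernoulli_trials p n) {\<omega>. P (prepend_trial True \<omega>)} +
    (1 - p) * measure_pmf.prob (bernoulli_trials p n) {\<omega>. P (prepend_trial False \<omega>)})"
    using assms
    unfolding bernoulli_trials_Suc emeasure_bind_pmf
    by (simp add: vimage_def measure_pmf.emeasure_eq_measure ennreal_plus ennreal_mult' mult.commute)
  then show ?thesis
    using assms by (simp add: measure_pmf.emeasure_eq_measure del: ennreal_plus)
qed

section \<open>Recurrences for the probabilities\<close>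

text \<open>The conditional probability given \<open>r\<close> leading successes. Only the
  \<open>n\<close> remaining trials are random, so a further success lowers \<open>n\<close> and
  raises \<open>r\<close>.\<close>

definition block_prob :: "real \<Rightarrow> nat \<Rightarrow> nat \<Rightarrow> nat \<Rightarrow> nat \<Rightarrow> nat \<Rightarrow> real" where
  "block_prob p k g t r n =
     measure_pmf.prob (bernoulli_trials p n) {\<omega>. long_run_after k g t (n + r) (prepend_successes r \<omega>) 0}"

definition delayed_prob :: "real \<Rightarrow> nat \<Rightarrow> nat \<Rightarrow> nat \<Rightarrow> nat \<Rightarrow> nat \<Rightarrow> real" where
  "delayed_prob p k g t s n = measure_pmf.prob (bernoulli_trials p n) {\<omega>. long_run_after k g t n \<omega> s}"

lemma block_prob_start: "block_prob p k g t 0 n = delayed_prob p k g t 0 n"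
  by (simp add: block_prob_def delayed_prob_def long_run_after_prepend_0)

lemma block_prob_end:
  assumes "1 \<le> k" "k \<le> t"
  shows "block_prob p k g t r 0 = (if t \<le> r then 1 else 0)"
  using assms by (simp add: block_prob_def long_run_after_all_successes)

lemma block_prob_Suc:
  assumes "0 \<le> p" "p \<le> 1" "1 \<le> k" "1 \<le> g" "k \<le> t"
  shows "block_prob p k g t r (Suc n) = p * block_prob p k g t (Suc r) n +
    (1 - p) * (if t \<le> r then 1 else delayed_prob p k g t (if r < k then 0 else g - 1) n)"
proof -
  have "block_prob p k g t r (Suc n) =
    measure_pmf.prob (bernoulli_trials p (Suc n))
      {\<omega>. long_run_after k g t (n + Suc r) (prepend_successes r \<omega>) 0}"
    by (simp add: block_prob_def)
  also have "\<dots> = p * block_prob p k g t (Suc r) n + (1 - p) * measure_pmf.prob (bernoulli_trials p n)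
      {\<omega>. t \<le> r \<or> long_run_after k g t n \<omega> (if r < k then 0 else g - 1)}"
    using assms
    by (subst prob_bernoulli_trials_Suc)
      (simp_all only: prepend_successes_True long_run_after_prepend_False block_prob_def)
  finally show ?thesis
    by (simp add: delayed_prob_def)
qed

text \<open>In the recurrence a failure contributes weight times 1, and a success keeps
  \<open>t \<le> r\<close>; hence \<open>r\<close> is arbitrary in the induction.\<close>

lemma block_prob_eq_1:
  assumes "0 \<le> p" "p \<le> 1" "1 \<le> k" "1 \<le> g" "k \<le> t" "t \<le> r"
  shows "block_prob p k g t r n = 1"
  using assms(6)
proof (induction n arbitrary: r)
  case 0
  then show ?case using assms by (simp add: block_prob_end)
next
  case (Suc n)
  then show ?case using assms(1-5) by (simp add: block_prob_Suc)
qed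

lemma delayed_prob_end: "delayed_prob p k g t s 0 = 0"
  by (simp add: delayed_prob_def not_long_run_after_end)

text \<open>A chain starting after \<open>Suc s\<close> never reads trial 1, so both outcomes of
  that trial give the same probability, with weights summing to 1.\<close>

lemma delayed_prob_Suc:
  assumes "0 \<le> p" "p \<le> 1"
  shows "delayed_prob p k g t (Suc s) (Suc n) = delayed_prob p k g t s n"
  using assms
  by (simp add: delayed_prob_def prob_bernoulli_trials_Suc long_run_after_prepend_trial algebra_simps)

lemma longest_run_prob_eq_delayed_prob:
  assumes "1 \<le> t"
  shows "longest_run_prob p k g n t = delayed_prob p k g t 0 n"
  using assms
  by (simp add: longest_run_prob_def delayed_prob_end le_longest_run_iff)
    (simp add: delayed_prob_def)

subsection \<open>Generating functions\<close>

lemma delayed_fps: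
  assumes "0 \<le> p" "p \<le> 1"
  shows "Abs_fps (delayed_prob p k g t s) = fps_X ^ s * Abs_fps (delayed_prob p k g t 0)"
proof (induction s)
  case (Suc s)
  have "Abs_fps (delayed_prob p k g t (Suc s)) = fps_X * Abs_fps (delayed_prob p k g t s)"
  proof (rule fps_ext)
    fix n
    show "fps_nth (Abs_fps (delayed_prob p k g t (Suc s))) n = fps_nth (fps_X * Abs_fps (delayed_prob p k g t s)) n"
      using assms by (cases n) (simp_all add: delayed_prob_end delayed_prob_Suc)
  qed
  then show ?case
    by (simp add: Suc mult.assoc)
qed simp

text \<open>By \<open>r < t\<close> the constant coefficient vanishes, so the one-step recurrence
  becomes a multiplication by \<open>fps_X\<close>.\<close>

lemma block_fps:
  assumes "0 \<le> p" "p \<le> 1" "1 \<le> k" "1 \<le> g" "k \<le> t" "r < t"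
  shows "Abs_fps (block_prob p k g t r) =
    fps_const p * fps_X * Abs_fps (block_prob p k g t (Suc r)) +
    fps_const (1 - p) * fps_X ^ (if r < k then 1 else g) * Abs_fps (delayed_prob p k g t 0)"
proof -
  let ?s = "if r < k then 0 else g - 1"
  have "Abs_fps (block_prob p k g t r) =
    fps_X * (fps_const p * Abs_fps (block_prob p k g t (Suc r)) +
      fps_const (1 - p) * Abs_fps (delayed_prob p k g t ?s))"
  proof (rule fps_ext)
    fix n
    show "fps_nth (Abs_fps (block_prob p k g t r)) n =
      fps_nth (fps_X * (fps_const p * Abs_fps (block_prob p k g t (Suc r)) +
        fps_const (1 - p) * Abs_fps (delayed_prob p k g t ?s))) n"
      using assms by (cases n) (simp_all add: block_prob_end block_prob_Suc)
  qed
  also have "Abs_fps (delayed_prob p k g t ?s) = fps_X ^ ?s * Abs_fps (delayed_prob p k g t 0)"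
    using assms by (intro delayed_fps)
  also have "fps_X * (fps_const p * Abs_fps (block_prob p k g t (Suc r)) +
      fps_const (1 - p) * (fps_X ^ ?s * Abs_fps (delayed_prob p k g t 0))) =
    fps_const p * fps_X * Abs_fps (block_prob p k g t (Suc r)) +
    fps_const (1 - p) * fps_X ^ Suc ?s * Abs_fps (delayed_prob p k g t 0)"
    by (simp only: power_Suc algebra_simps)
  \<comment> \<open>One power of \<open>fps_X\<close> is for the failure itself, the others for the
    rest of the gap.\<close>
  also have "Suc ?s = (if r < k then 1 else g)"
    using assms by simp
  finally show ?thesis .
qed

lemma linear_recurrence_telescope:
  fixes U V :: "nat \<Rightarrow> 'a :: comm_ring_1"
  assumes "\<And>r. r < m \<Longrightarrow> U r = c * U (Suc r) + V r"
  shows "U 0 = c ^ m * U m + (\<Sum>r<m. c ^ r * V r)"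
  using assms by (induction m) (simp_all add: algebra_simps)

lemma fps_one_over_one_minus_X:
  "(1 - fps_X) * Abs_fps (\<lambda>_. 1 :: 'a :: comm_ring_1) = 1"
  by (rule fps_ext) (simp add: algebra_simps)

theorem mainTheorem7:
  fixes k g t :: nat and p q :: real
  assumes "k \<ge> 1" and "g \<ge> 1" and "t \<ge> k"
    and "0 < p" and "p < 1" and "q = 1 - p"
  shows "Abs_fps (\<lambda>n. longest_run_prob p k g n t) =
    (1 - fps_const p * fps_X) / (1 - fps_X) *
    ((fps_const (p ^ t) * fps_X ^ t) /
     (1 - fps_X + fps_const (q * p ^ k) * (fps_X ^ (k + 1) - fps_X ^ (k + g))
        + fps_const (q * p ^ t) * fps_X ^ (t + g)))"
proof -
  let ?F = "Abs_fps (\<lambda>n. longest_run_prob p k g n t)"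
  let ?D = "1 - fps_X + fps_const (q * p ^ k) * (fps_X ^ (k + 1) - fps_X ^ (k + g))
        + fps_const (q * p ^ t) * fps_X ^ (t + g)"
  \<comment> \<open>\<open>c\<close> is the weight of one success; \<open>V r\<close> is that of the
    failure ending a block of \<open>r\<close> successes, together with the gap and the restarted
    process.\<close>
  define c where "c = fps_const p * fps_X"
  define V where "V r = fps_const q * fps_X ^ (if r < k then 1 else g) * ?F" for r
  have c_pow: "c ^ m = fps_const (p ^ m) * fps_X ^ m" for m
    by (simp add: c_def power_mult_distrib fps_const_power)
  have F: "?F = Abs_fps (delayed_prob p k g t 0)"
    using assms by (simp add: longest_run_prob_eq_delayed_prob)
  have "Abs_fps (block_prob p k g t 0) =
      c ^ t * Abs_fps (block_prob p k g t t) + (\<Sum>r<t. c ^ r * V r)"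
    unfolding c_def V_def F \<open>q = 1 - p\<close>
    using assms by (intro linear_recurrence_telescope block_fps) auto
  moreover have "Abs_fps (\<lambda>n. block_prob p k g t 0 n) = ?F"
    unfolding F block_prob_start ..
  \<comment> \<open>A block of \<open>t\<close> successes is already long whatever follows, so this
    series is \<open>1 / (1 - fps_X)\<close>.\<close>
  moreover have "Abs_fps (block_prob p k g t t) = Abs_fps (\<lambda>_. 1)"
    using assms by (intro fps_ext) (simp add: block_prob_eq_1)
  ultimately have F_eq: "?F = c ^ t * Abs_fps (\<lambda>_. 1) + (\<Sum>r<t. c ^ r * V r)"
    by simp
  have geometric: "(1 - c) * (\<Sum>r<m. c ^ r) = 1 - c ^ m" for m
    by (simp add: one_diff_power_eq)
  \<comment> \<open>The sum is split at \<open>k\<close>, where the exponent in \<open>V\<close>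
    changes from 1 to \<open>g\<close>.\<close>
  have "(\<Sum>r<t. c ^ r * V r) = (\<Sum>r<k. c ^ r * V r) + (\<Sum>r\<in>{k..<t}. c ^ r * V r)"
    using assms by (simp add: lessThan_atLeast0 sum.atLeastLessThan_concat)
  also have "(\<Sum>r<k. c ^ r * V r) = fps_const q * fps_X * ?F * (\<Sum>r<k. c ^ r)"
    by (simp add: V_def sum_distrib_left sum_distrib_right mult_ac)
  also have "(\<Sum>r\<in>{k..<t}. c ^ r * V r) = fps_const q * fps_X ^ g * ?F * (\<Sum>r\<in>{k..<t}. c ^ r)"
    by (simp add: V_def sum_distrib_left sum_distrib_right mult_ac)
  also have "(\<Sum>r\<in>{k..<t}. c ^ r) = (\<Sum>r<t. c ^ r) - (\<Sum>r<k. c ^ r)"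
    using sum.atLeastLessThan_concat[of 0 k t "\<lambda>r. c ^ r"] assms
    by (simp add: lessThan_atLeast0 eq_diff_eq add.commute)
  finally have "(\<Sum>r<t. c ^ r * V r) = fps_const q * fps_X * ?F * (\<Sum>r<k. c ^ r) +
      fps_const q * fps_X ^ g * ?F * ((\<Sum>r<t. c ^ r) - (\<Sum>r<k. c ^ r))" .
  then have sum_eq: "(1 - c) * (\<Sum>r<t. c ^ r * V r) =
      fps_const q * fps_X * ?F * ((1 - c) * (\<Sum>r<k. c ^ r)) +
      fps_const q * fps_X ^ g * ?F * ((1 - c) * (\<Sum>r<t. c ^ r) - (1 - c) * (\<Sum>r<k. c ^ r))"
    by (simp only: distrib_left right_diff_distrib mult_ac)
  have F_linear: "(1 - c) * ?F = (1 - c) * c ^ t * Abs_fps (\<lambda>_. 1) +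
      fps_const q * fps_X * ?F * (1 - c ^ k) + fps_const q * fps_X ^ g * ?F * (c ^ k - c ^ t)"
    using arg_cong[OF F_eq, of "(*) (1 - c)"]
    unfolding distrib_left sum_eq geometric by (simp add: algebra_simps)
  have D_eq: "?D = 1 - c - fps_const q * fps_X * (1 - c ^ k) - fps_const q * fps_X ^ g * (c ^ k - c ^ t)"
  proof -
    \<comment> \<open>From \<open>p + q = 1\<close>; it turns \<open>1 - fps_X\<close> into
      \<open>1 - c - fps_const q * fps_X\<close>.\<close>
    have "fps_X = c + fps_const q * fps_X"
      using \<open>q = 1 - p\<close> by (simp add: c_def flip: distrib_right)
    moreover have "?D = 1 - fps_X + fps_const q * fps_X * c ^ k
        - fps_const q * fps_X ^ g * (c ^ k - c ^ t)"
      by (simp add: c_pow power_add algebra_simps flip: fps_const_mult)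
    ultimately show ?thesis
      by (simp add: algebra_simps)
  qed
  have "?F * ?D = (1 - c) * c ^ t * Abs_fps (\<lambda>_. 1)"
    unfolding D_eq using F_linear by (simp add: algebra_simps)
  then have "?F * ((1 - fps_X) * ?D) = (1 - c) * c ^ t * ((1 - fps_X) * Abs_fps (\<lambda>_. 1))"
    by (simp only: mult.left_commute)
  then have key: "?F * ((1 - fps_X) * ?D) = (1 - c) * c ^ t"
    by (simp only: fps_one_over_one_minus_X mult_1_right)
  \<comment> \<open>Both constant terms are 1, since every power of \<open>fps_X\<close> that occurs
    has a positive exponent; division is then multiplication by the inverse series.\<close>
  have units: "fps_nth (1 - fps_X :: real fps) 0 \<noteq> 0" "fps_nth ?D 0 \<noteq> 0"
    using assms by simp_all
  have "?F = ?F * ((1 - fps_X) * inverse (1 - fps_X)) * (?D * inverse ?D)"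
    by (simp only: inverse_mult_eq_1'[OF units(1)] inverse_mult_eq_1'[OF units(2)] mult_1_right)
  also have "\<dots> = ?F * ((1 - fps_X) * ?D) * (inverse (1 - fps_X) * inverse ?D)"
    by (simp only: mult_ac)
  finally have "?F = (1 - c) * c ^ t * (inverse (1 - fps_X) * inverse ?D)"
    by (simp only: key)
  then show ?thesis
    unfolding fps_divide_unit[OF units(1)] fps_divide_unit[OF units(2)] c_pow
    unfolding c_def by (simp only: mult_ac)
qed

end
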